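(* Let $\mathfrak{a}$ be a bilinear map on $H^1(\mathcal{O},\mathfrak{w})$ obeying the weak maximum principle property on $\mathcal{O}\cup\Sigma$ for $\mathfrak{K}$, for some relatively open $\Sigma\subseteq\partial\mathcal{O}$ and convex cone $\mathfrak{K}\subset H^1(\mathcal{O},\mathfrak{w})$. Suppose that $u,-v\in\mathfrak{K}$. If $\mathfrak{a}(u,\cdot)\le\mathfrak{a}(v,\cdot)$ and $u\le v$ on $\partial\mathcal{O}\setminus\Sigma$ in the sense of $H^1(\mathcal{O},\mathfrak{w})$, then $u\le v$ a.e. on $\mathcal{O}$; if $\mathfrak{a}(u,\cdot)=\mathfrak{a}(v,\cdot)$ and $u=v$ on $\partial\mathcal{O}\setminus\Sigma$ in the sense of $H^1(\mathcal{O},\mathfrak{w})$, then $u=v$ a.e. on $\mathcal{O}$.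
   Context: $\mathcal{O}\subseteq\mathbb{R}^d$ is open. A weight function on $\mathcal{O}$ is $\mathfrak{w}\in C(\mathcal{O})\cap L^1(\mathcal{O})$ with $\mathfrak{w}>0$ on $\mathcal{O}$. Given weight functions $\mathfrak{w}_{1,0},\mathfrak{w}_{1,1}$, $H^1(\mathcal{O},\mathfrak{w})$ is the completion of $C^\infty_0(\bar{\mathcal{O}})$ in the norm $\|u\|^2=\int_{\mathcal{O}}(|Du|^2\mathfrak{w}_{1,1}+|u|^2\mathfrak{w}_{1,0})\,dx$. For relatively open $\Sigma\subseteq\partial\mathcal{O}$, $C^\infty_0(\mathcal{O}\cup\Sigma)$ is the space of smooth functions with compact support in $\mathcal{O}\cup\Sigma$, and $H^1_0(\mathcal{O}\cup\Sigma,\mathfrak{w})$ is its closure in $H^1(\mathcal{O},\mathfrak{w})$. "$u\le v$ on $\partial\mathcal{O}\setminus\Sigma$ in the sense of $H^1(\mathcal{O},\mathfrak{w})$" means $(u-v)^+\in H^1_0(\mathcal{O}\cup\Sigma,\mathfrak{w})$; "$u=v$ on $\partial\mathcal{O}\setminus\Sigma$" in this sense means $u-v\in H^1_0(\mathcal{O}\cup\Sigma,\mathfrak{w})$. "$\mathfrak{a}(u,\cdot)\le\mathfrak{a}(v,\cdot)$" means $\mathfrak{a}(u,\phi)\le\mathfrak{a}(v,\phi)$ for all $\phi\in H^1_0(\mathcal{O}\cup\Sigma,\mathfrak{w})$ with $\phi\ge 0$ a.e. on $\mathcal{O}$, and equality is defined similarly. Weak maximum principle property: $\mathfrak{a}$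 obeys it on $\mathcal{O}\cup\Sigma$ for $\mathfrak{K}$ if whenever $u\in\mathfrak{K}$ obeys $\mathfrak{a}(u,\phi)\le 0$ for all $\phi\in H^1_0(\mathcal{O}\cup\Sigma,\mathfrak{w})$ with $\phi\ge 0$ a.e. on $\mathcal{O}$, and $u\le 0$ on $\partial\mathcal{O}\setminus\Sigma$ in the sense of $H^1(\mathcal{O},\mathfrak{w})$, then $u\le 0$ a.e. on $\mathcal{O}$.
   Formalization: The uniqueness clause additionally assumes v − u ∈ 𝔎; without it the claim is false (take 𝔞 = 0, 𝔎 = {f ≤ 0 a.e.}, u = −f, v = f with 0 ≤ f ∈ C₀^∞(𝒪), f ≠ 0). *)

theory Defs
  imports "HOL-Analysis.Analysis"
begin

definition weight_function :: "(real^'d) set \<Rightarrow> (real^'d \<Rightarrow> real) \<Rightarrow> bool" where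
  "weight_function \<Omega> w \<longleftrightarrow>
     continuous_on \<Omega> w \<and> set_integrable lebesgue \<Omega> w \<and> (\<forall>x\<in>\<Omega>. w x > 0)"

definition partial_deriv :: "'d \<Rightarrow> (real^'d \<Rightarrow> real) \<Rightarrow> real^'d \<Rightarrow> real" where
  "partial_deriv i f x = frechet_derivative f (at x) (axis i 1)"

definition grad :: "(real^'d \<Rightarrow> real) \<Rightarrow> real^'d \<Rightarrow> real^'d" where
  "grad f x = (\<chi> i. partial_deriv i f x)"

(* C^k up to the boundary portion contained in T, where \<Omega> \<subseteq> T \<subseteq> closure \<Omega>: the partial
   derivatives of order at most k exist on the open set \<Omega> and each of them extends
   continuously to T.  Only the values of f on \<Omega> matter. *)
fun Ck_upto :: "nat \<Rightarrow> (real^'d) set \<Rightarrow> (real^'d) set \<Rightarrow> (real^'d \<Rightarrow> real) \<Rightarrow> bool" where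
  "Ck_upto 0 \<Omega> T f \<longleftrightarrow> (\<exists>g. continuous_on T g \<and> (\<forall>x\<in>\<Omega>. g x = f x))"
| "Ck_upto (Suc k) \<Omega> T f \<longleftrightarrow>
     (\<exists>g. continuous_on T g \<and> (\<forall>x\<in>\<Omega>. g x = f x)) \<and>
     (\<forall>x\<in>\<Omega>. f differentiable (at x)) \<and>
     (\<forall>i. Ck_upto k \<Omega> T (partial_deriv i f))"

(* Test functions on T: smooth up to T and with compact support in T.  T = closure \<Omega> and
   T = \<Omega> \<union> \<Sigma> give the two spaces of test functions used below. *)
definition C0_infinity :: "(real^'d) set \<Rightarrow> (real^'d) set \<Rightarrow> (real^'d \<Rightarrow> real) set" where
  "C0_infinity \<Omega> T =
     {f. (\<forall>k. Ck_upto k \<Omega> T f) \<and>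
         compact (closure {x\<in>\<Omega>. f x \<noteq> 0}) \<and> closure {x\<in>\<Omega>. f x \<noteq> 0} \<subseteq> T}"

(* The squared H^1 norm of a function u with gradient G; w0 and w1 are the weights of the
   function and of the gradient, respectively. *)
definition H1_norm_sq ::
  "(real^'d) set \<Rightarrow> (real^'d \<Rightarrow> real) \<Rightarrow> (real^'d \<Rightarrow> real) \<Rightarrow>
   (real^'d \<Rightarrow> real) \<Rightarrow> (real^'d \<Rightarrow> real^'d) \<Rightarrow> ennreal" where
  "H1_norm_sq \<Omega> w0 w1 u G =
     (\<integral>\<^sup>+x. ennreal ((norm (G x))\<^sup>2 * w1 x + \<bar>u x\<bar>\<^sup>2 * w0 x) \<partial>lebesgue_on \<Omega>)"

(* The norm on test functions is pulled back along \<phi> \<mapsto> (\<phi>, grad \<phi>) from the complete space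
   L^2(\<Omega>, w0) x L^2(\<Omega>, w1; R^d), so the completion of a space S of test functions is the
   closure of its image there.  The weights are continuous and positive, hence bounded
   below on compact subsets of \<Omega>; so convergence implies L^2_loc convergence, G is the weak
   gradient of u on \<Omega>, and u determines G up to null sets.  Elements of the completion are
   therefore represented by their first component. *)
definition H1_completion ::
  "(real^'d) set \<Rightarrow> (real^'d \<Rightarrow> real) \<Rightarrow> (real^'d \<Rightarrow> real) \<Rightarrow> (real^'d \<Rightarrow> real) set \<Rightarrow>
   ((real^'d \<Rightarrow> real) \<times> (real^'d \<Rightarrow> real^'d)) set" where
  "H1_completion \<Omega> w0 w1 S =
     {(u, G). u \<in> borel_measurable (lebesgue_on \<Omega>) \<and> G \<in> borel_measurable (lebesgue_on \<Omega>) \<and>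
        (\<forall>e>0. \<exists>\<phi>\<in>S. H1_norm_sq \<Omega> w0 w1 (\<lambda>x. u x - \<phi> x) (\<lambda>x. G x - grad \<phi> x) < ennreal e)}"

definition H1 ::
  "(real^'d) set \<Rightarrow> (real^'d \<Rightarrow> real) \<Rightarrow> (real^'d \<Rightarrow> real) \<Rightarrow> (real^'d \<Rightarrow> real) set" where
  "H1 \<Omega> w0 w1 = fst ` H1_completion \<Omega> w0 w1 (C0_infinity \<Omega> (closure \<Omega>))"

definition H1_0 ::
  "(real^'d) set \<Rightarrow> (real^'d) set \<Rightarrow> (real^'d \<Rightarrow> real) \<Rightarrow> (real^'d \<Rightarrow> real) \<Rightarrow>
   (real^'d \<Rightarrow> real) set" where
  "H1_0 \<Omega> \<Sigma> w0 w1 =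
     fst ` {(u, G) \<in> H1_completion \<Omega> w0 w1 (C0_infinity \<Omega> (closure \<Omega>)).
       \<forall>e>0. \<exists>\<phi> \<in> C0_infinity \<Omega> (\<Omega> \<union> \<Sigma>).
         H1_norm_sq \<Omega> w0 w1 (\<lambda>x. u x - \<phi> x) (\<lambda>x. G x - grad \<phi> x) < ennreal e}"

definition ae_le :: "(real^'d) set \<Rightarrow> (real^'d \<Rightarrow> real) \<Rightarrow> (real^'d \<Rightarrow> real) \<Rightarrow> bool" where
  "ae_le \<Omega> u v \<longleftrightarrow> (AE x in lebesgue_on \<Omega>. u x \<le> v x)"

definition ae_eq :: "(real^'d) set \<Rightarrow> (real^'d \<Rightarrow> real) \<Rightarrow> (real^'d \<Rightarrow> real) \<Rightarrow> bool" where
  "ae_eq \<Omega> u v \<longleftrightarrow> (AE x in lebesgue_on \<Omega>. u x = v x)"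

(* H is a space of functions whose elements are identified when equal a.e. on \<Omega>; the last
   conjunct says that a is well defined on the classes. *)
definition bilinear_map_on ::
  "(real^'d) set \<Rightarrow> (real^'d \<Rightarrow> real) set \<Rightarrow>
   ((real^'d \<Rightarrow> real) \<Rightarrow> (real^'d \<Rightarrow> real) \<Rightarrow> real) \<Rightarrow> bool" where
  "bilinear_map_on \<Omega> H a \<longleftrightarrow>
     (\<forall>f\<in>H. \<forall>g\<in>H. \<forall>h\<in>H. a (\<lambda>x. f x + g x) h = a f h + a g h) \<and>
     (\<forall>f\<in>H. \<forall>g\<in>H. \<forall>h\<in>H. a h (\<lambda>x. f x + g x) = a h f + a h g) \<and>
     (\<forall>c. \<forall>f\<in>H. \<forall>h\<in>H. a (\<lambda>x. c * f x) h = c * a f h) \<and>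
     (\<forall>c. \<forall>f\<in>H. \<forall>h\<in>H. a h (\<lambda>x. c * f x) = c * a h f) \<and>
     (\<forall>f\<in>H. \<forall>f'\<in>H. \<forall>h\<in>H. \<forall>h'\<in>H. ae_eq \<Omega> f f' \<longrightarrow> ae_eq \<Omega> h h' \<longrightarrow> a f h = a f' h')"

(* Function types carry no real_vector structure, so the library notions cone and convex
   are not applicable.  As above, K is a set of a.e. classes. *)
definition convex_cone_in ::
  "(real^'d) set \<Rightarrow> (real^'d \<Rightarrow> real) set \<Rightarrow> (real^'d \<Rightarrow> real) set \<Rightarrow> bool" where
  "convex_cone_in \<Omega> H K \<longleftrightarrow>
     K \<subseteq> H \<and>
     (\<forall>f\<in>K. \<forall>c>0. (\<lambda>x. c * f x) \<in> K) \<and>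
     (\<forall>f\<in>K. \<forall>g\<in>K. \<forall>t\<in>{0..1}. (\<lambda>x. (1 - t) * f x + t * g x) \<in> K) \<and>
     (\<forall>f\<in>K. \<forall>f'\<in>H. ae_eq \<Omega> f f' \<longrightarrow> f' \<in> K)"

definition boundary_le ::
  "(real^'d) set \<Rightarrow> (real^'d) set \<Rightarrow> (real^'d \<Rightarrow> real) \<Rightarrow> (real^'d \<Rightarrow> real) \<Rightarrow>
   (real^'d \<Rightarrow> real) \<Rightarrow> (real^'d \<Rightarrow> real) \<Rightarrow> bool" where
  "boundary_le \<Omega> \<Sigma> w0 w1 u v \<longleftrightarrow> (\<lambda>x. max (u x - v x) 0) \<in> H1_0 \<Omega> \<Sigma> w0 w1"

definition boundary_eq ::
  "(real^'d) set \<Rightarrow> (real^'d) set \<Rightarrow> (real^'d \<Rightarrow> real) \<Rightarrow> (real^'d \<Rightarrow> real) \<Rightarrow>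
   (real^'d \<Rightarrow> real) \<Rightarrow> (real^'d \<Rightarrow> real) \<Rightarrow> bool" where
  "boundary_eq \<Omega> \<Sigma> w0 w1 u v \<longleftrightarrow> (\<lambda>x. u x - v x) \<in> H1_0 \<Omega> \<Sigma> w0 w1"

definition form_le ::
  "(real^'d) set \<Rightarrow> (real^'d) set \<Rightarrow> (real^'d \<Rightarrow> real) \<Rightarrow> (real^'d \<Rightarrow> real) \<Rightarrow>
   ((real^'d \<Rightarrow> real) \<Rightarrow> (real^'d \<Rightarrow> real) \<Rightarrow> real) \<Rightarrow>
   (real^'d \<Rightarrow> real) \<Rightarrow> (real^'d \<Rightarrow> real) \<Rightarrow> bool" where
  "form_le \<Omega> \<Sigma> w0 w1 a u v \<longleftrightarrow>
     (\<forall>\<phi> \<in> H1_0 \<Omega> \<Sigma> w0 w1. ae_le \<Omega> (\<lambda>x. 0) \<phi> \<longrightarrow> a u \<phi> \<le> a v \<phi>)"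

definition form_eq ::
  "(real^'d) set \<Rightarrow> (real^'d) set \<Rightarrow> (real^'d \<Rightarrow> real) \<Rightarrow> (real^'d \<Rightarrow> real) \<Rightarrow>
   ((real^'d \<Rightarrow> real) \<Rightarrow> (real^'d \<Rightarrow> real) \<Rightarrow> real) \<Rightarrow>
   (real^'d \<Rightarrow> real) \<Rightarrow> (real^'d \<Rightarrow> real) \<Rightarrow> bool" where
  "form_eq \<Omega> \<Sigma> w0 w1 a u v \<longleftrightarrow>
     (\<forall>\<phi> \<in> H1_0 \<Omega> \<Sigma> w0 w1. ae_le \<Omega> (\<lambda>x. 0) \<phi> \<longrightarrow> a u \<phi> = a v \<phi>)"

(* K is only a cone, so u, -v \<in> K yields a statement about u - v but none about v - u.  For
   K = {f \<in> H1. f \<le> 0 a.e.} and a = 0 the principle holds trivially, whereas form_eq and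
   boundary_eq hold for u = -f, v = f with any f \<ge> 0 in C0_infinity \<Omega> \<Omega>; a uniqueness
   result therefore has to require v - u \<in> K as well. *)
definition weak_maximum_principle ::
  "(real^'d) set \<Rightarrow> (real^'d) set \<Rightarrow> (real^'d \<Rightarrow> real) \<Rightarrow> (real^'d \<Rightarrow> real) \<Rightarrow>
   ((real^'d \<Rightarrow> real) \<Rightarrow> (real^'d \<Rightarrow> real) \<Rightarrow> real) \<Rightarrow> (real^'d \<Rightarrow> real) set \<Rightarrow> bool" where
  "weak_maximum_principle \<Omega> \<Sigma> w0 w1 a K \<longleftrightarrow>
     (\<forall>u\<in>K.
        (\<forall>\<phi> \<in> H1_0 \<Omega> \<Sigma> w0 w1. ae_le \<Omega> (\<lambda>x. 0) \<phi> \<longrightarrow> a u \<phi> \<le> 0) \<longrightarrow>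
        boundary_le \<Omega> \<Sigma> w0 w1 u (\<lambda>x. 0) \<longrightarrow>
        ae_le \<Omega> u (\<lambda>x. 0))"

end

theory Submission
  imports Defs
begin

text \<open>
  Bilinearity turns both claims into applications of the weak maximum principle to a difference.
  The hypotheses on \<^term>\<open>u\<close> and \<^term>\<open>v\<close> say that \<open>a (u - v, \<phi>) \<le> 0\<close> for all admissible
  \<open>\<phi> \<ge> 0\<close> and that \<open>u - v \<le> 0\<close> on the boundary portion; since a convex cone is closed under
  addition, \<open>u - v\<close> is in the cone, and the principle gives \<open>u - v \<le> 0\<close>. This is
  \<open>weak_maximum_principle_comparison\<close>. For uniqueness it is applied in both directions,
  with \<open>v - u\<close> in the cone for the second.

  The analytic content is in the second claim. Equality on the boundary portion says that \<open>u - v\<close>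
  lies in the space of functions vanishing there, whereas the inequalities ask the same of
  the positive parts of \<open>u - v\<close> and \<open>v - u\<close>. So that space has to be closed under
  \<open>u \<mapsto> max u 0\<close>, which is \<open>H1_0_pos_part\<close>. The space is a closure of smooth test functions,
  and \<open>max u 0\<close> is approximated by \<open>h\<^sub>k (\<phi>)\<close>, where \<open>\<phi>\<close> is a test function close to \<open>u\<close> and
  \<open>h\<^sub>k (t) = (ln (1 + exp (k t)) - ln 2) / k\<close>. This \<open>h\<^sub>k\<close> is smooth, vanishes at 0 (so that
  supports do not grow), is within \<open>1 / k\<close> of the positive part, and has derivative
  \<open>\<sigma> (k t)\<close> for the logistic function \<open>\<sigma>\<close>. As \<open>k \<rightarrow> \<infinity>\<close>, \<open>\<sigma> (k t)\<close> tends to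
  \<open>(1 + sgn t) / 2\<close> at every \<open>t\<close>, including 0. Hence \<open>max u 0\<close> has the gradient
  \<open>((1 + sgn u) / 2) G\<close> if \<open>u\<close> has the gradient \<open>G\<close>.

  The delicate term in the convergence of the gradients is \<open>(\<sigma> (k u) - \<sigma> (k \<phi>)) G\<close>, because
  \<open>G\<close> is merely square integrable. It is cut at the level \<open>\<bar>G\<bar>\<^sup>2 w1 = k w0\<close>: above the level it is
  bounded by \<open>G\<close> restricted to a set that shrinks to the empty set, below it by the
  distance of \<open>u\<close> and \<open>\<phi>\<close> with a factor depending on \<open>k\<close> only. Thus \<open>k\<close> is
  chosen by dominated convergence, and then \<open>\<phi>\<close> so close to \<open>u\<close> that the factor is compensated
  (\<open>softplus_pointwise\<close>, \<open>H1_completion_pos_part\<close>).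
\<close>

section \<open>Algebra and chain rule for functions smooth up to the boundary\<close>

lemma partial_deriv_eqI:
  assumes "(f has_derivative f') (at x)"
  shows "partial_deriv i f x = f' (axis i 1)"
  using frechet_derivative_at[OF assms] by (simp add: partial_deriv_def)

text \<open>
  \<^const>\<open>frechet_derivative\<close> is a choice among all derivatives at the point, so functions that
  agree near the point have the same one even where no derivative exists.
\<close>

lemma differentiable_cong_open:
  assumes "open S" "x \<in> S" "\<And>y. y \<in> S \<Longrightarrow> f y = g y"
  shows "f differentiable (at x) \<longleftrightarrow> g differentiable (at x)"
    and "partial_deriv i f x = partial_deriv i g x"
proof -
  have "(f has_derivative f') (at x) \<longleftrightarrow> (g has_derivative f') (at x)" for f'
    using assms has_derivative_transform_within_open[of _ f' x UNIV S] by metis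
  then show "f differentiable (at x) \<longleftrightarrow> g differentiable (at x)"
    and "partial_deriv i f x = partial_deriv i g x"
    by (simp_all add: differentiable_def partial_deriv_def frechet_derivative_def)
qed

lemma Ck_upto_cong:
  assumes "open \<Omega>" "Ck_upto k \<Omega> T f" "\<And>x. x \<in> \<Omega> \<Longrightarrow> f x = g x"
  shows "Ck_upto k \<Omega> T g"
  using assms(2,3)
proof (induction k arbitrary: f g)
  case 0
  then show ?case by simp
next
  case (Suc k)
  have "Ck_upto k \<Omega> T (partial_deriv i g)" for i
  proof (rule Suc.IH)
    show "Ck_upto k \<Omega> T (partial_deriv i f)" using Suc.prems by simp
    show "partial_deriv i f x = partial_deriv i g x" if "x \<in> \<Omega>" for x
      using Suc.prems(2) by (rule differentiable_cong_open(2)[OF assms(1) that])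
  qed
  moreover have "g differentiable (at x)" if "x \<in> \<Omega>" for x
  proof -
    have "f differentiable (at x)" using Suc.prems(1) that by simp
    then show ?thesis
      using differentiable_cong_open(1)[OF assms(1) that, of f g] Suc.prems(2) by blast
  qed
  ultimately show ?case using Suc.prems by simp
qed

text \<open>
  Partial derivatives are computed by the usual rules on the open set only; this rule lets the
  resulting expression stand for the partial derivative.
\<close>

lemma Ck_upto_SucI:
  assumes "open \<Omega>" "Ck_upto 0 \<Omega> T f" "\<And>x. x \<in> \<Omega> \<Longrightarrow> f differentiable (at x)"
    and "\<And>i. Ck_upto k \<Omega> T (f' i)" "\<And>i x. x \<in> \<Omega> \<Longrightarrow> partial_deriv i f x = f' i x"
  shows "Ck_upto (Suc k) \<Omega> T f"
proof -
  have "Ck_upto k \<Omega> T (partial_deriv i f)" for i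
    by (rule Ck_upto_cong[OF assms(1) assms(4)[of i]]) (simp add: assms(5))
  then show ?thesis using assms(2,3) by simp
qed

lemma Ck_upto_const:
  "Ck_upto k \<Omega> T (\<lambda>x. c)"
proof (induction k arbitrary: c)
  case 0
  show ?case by (auto intro!: exI[of _ "\<lambda>x. c"])
next
  case (Suc k)
  have "partial_deriv i (\<lambda>x. c) = (\<lambda>x. 0)" for i :: 'a
    by (simp add: partial_deriv_def fun_eq_iff)
  moreover have "Ck_upto k \<Omega> T (\<lambda>x. 0)" by (rule Suc.IH)
  ultimately show ?case by (auto intro!: exI[of _ "\<lambda>x. c"])
qed

lemma Ck_upto_0: "Ck_upto k \<Omega> T f \<Longrightarrow> Ck_upto 0 \<Omega> T f"
  by (cases k) auto

lemma Ck_upto_Suc_imp: "Ck_upto (Suc k) \<Omega> T f \<Longrightarrow> Ck_upto k \<Omega> T f"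
proof (induction k arbitrary: f)
  case 0
  then show ?case by simp
next
  case (Suc k)
  then have "Ck_upto k \<Omega> T (partial_deriv i f)" for i by (metis Ck_upto.simps(2))
  then show ?case using Suc.prems by simp
qed

lemma partial_deriv_add:
  assumes "f differentiable (at x)" "g differentiable (at x)"
  shows "partial_deriv i (\<lambda>x. f x + g x) x = partial_deriv i f x + partial_deriv i g x"
  using assms unfolding frechet_derivative_works
  by (subst partial_deriv_eqI[OF has_derivative_add]) (auto simp: partial_deriv_def)

lemma partial_deriv_mult:
  assumes "f differentiable (at x)" "g differentiable (at x)"
  shows "partial_deriv i (\<lambda>x. f x * g x) x = f x * partial_deriv i g x + partial_deriv i f x * g x"
  using assms unfolding frechet_derivative_works
  by (subst partial_deriv_eqI[OF has_derivative_mult]) (auto simp: partial_deriv_def)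

lemma Ck_upto_0_compose:
  assumes "Ck_upto 0 \<Omega> T f" "continuous_on UNIV h"
  shows "Ck_upto 0 \<Omega> T (\<lambda>x. h (f x))"
proof -
  obtain g where "continuous_on T g" "\<forall>x\<in>\<Omega>. g x = f x" using assms(1) by auto
  then show ?thesis
    using continuous_on_compose2[OF assms(2), of T g] by (auto intro!: exI[of _ "\<lambda>x. h (g x)"])
qed

lemma Ck_upto_add:
  assumes "open \<Omega>" "Ck_upto k \<Omega> T f" "Ck_upto k \<Omega> T g"
  shows "Ck_upto k \<Omega> T (\<lambda>x. f x + g x)"
  using assms(2,3)
proof (induction k arbitrary: f g)
  case 0
  then obtain f' g' where "continuous_on T f'" "\<forall>x\<in>\<Omega>. f' x = f x"
    "continuous_on T g'" "\<forall>x\<in>\<Omega>. g' x = g x" by auto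
  then show ?case by (auto intro!: exI[of _ "\<lambda>x. f' x + g' x"] continuous_intros)
next
  case (Suc k)
  show ?case
  proof (rule Ck_upto_SucI[OF assms(1)])
    obtain f' g' where "continuous_on T f'" "\<forall>x\<in>\<Omega>. f' x = f x"
      "continuous_on T g'" "\<forall>x\<in>\<Omega>. g' x = g x" using Suc.prems by auto
    then show "Ck_upto 0 \<Omega> T (\<lambda>x. f x + g x)"
      by (auto intro!: exI[of _ "\<lambda>x. f' x + g' x"] continuous_intros)
    show "Ck_upto k \<Omega> T (\<lambda>x. partial_deriv i f x + partial_deriv i g x)" for i
      using Suc by simp
  qed (use Suc.prems in \<open>auto simp: partial_deriv_add\<close>)
qed

lemma Ck_upto_mult:
  assumes "open \<Omega>" "Ck_upto k \<Omega> T f" "Ck_upto k \<Omega> T g"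
  shows "Ck_upto k \<Omega> T (\<lambda>x. f x * g x)"
  using assms(2,3)
proof (induction k arbitrary: f g)
  case 0
  then obtain f' g' where "continuous_on T f'" "\<forall>x\<in>\<Omega>. f' x = f x"
    "continuous_on T g'" "\<forall>x\<in>\<Omega>. g' x = g x" by auto
  then show ?case by (auto intro!: exI[of _ "\<lambda>x. f' x * g' x"] continuous_intros)
next
  case (Suc k)
  show ?case
  proof (rule Ck_upto_SucI[OF assms(1)])
    obtain f' g' where "continuous_on T f'" "\<forall>x\<in>\<Omega>. f' x = f x"
      "continuous_on T g'" "\<forall>x\<in>\<Omega>. g' x = g x" using Suc.prems by auto
    then show "Ck_upto 0 \<Omega> T (\<lambda>x. f x * g x)"
      by (auto intro!: exI[of _ "\<lambda>x. f' x * g' x"] continuous_intros)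
    show "Ck_upto k \<Omega> T (\<lambda>x. f x * partial_deriv i g x + partial_deriv i f x * g x)" for i
      using Suc.prems Suc.IH[of f "partial_deriv i g"] Suc.IH[of "partial_deriv i f" g]
        Ck_upto_Suc_imp[of k \<Omega> T f] Ck_upto_Suc_imp[of k \<Omega> T g]
      by (intro Ck_upto_add[OF assms(1)]) auto
  qed (use Suc.prems in \<open>auto simp: partial_deriv_mult\<close>)
qed

lemma has_derivative_compose_real:
  fixes f :: "real^'d \<Rightarrow> real"
  assumes "f differentiable (at x)" "(h has_real_derivative h') (at (f x))"
  shows "((\<lambda>x. h (f x)) has_derivative (\<lambda>y. h' * frechet_derivative f (at x) y)) (at x)"
  using has_derivative_compose[OF assms(1)[unfolded frechet_derivative_works]
      assms(2)[unfolded has_field_derivative_def]] by simp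

lemma partial_deriv_compose:
  assumes "f differentiable (at x)" "(h has_real_derivative h') (at (f x))"
  shows "partial_deriv i (\<lambda>x. h (f x)) x = h' * partial_deriv i f x"
  using partial_deriv_eqI[OF has_derivative_compose_real[OF assms]] by (simp add: partial_deriv_def)

text \<open>
  One step of the chain rule, with the regularity of \<open>h' \<circ> f\<close> left as a premise. It suffices
  for functions \<open>h\<close> whose derivative is a polynomial in \<open>h\<close>, as for the
  logistic function, or is a function whose composites are already known to be regular.
\<close>

lemma Ck_upto_Suc_compose:
  assumes "open \<Omega>" "Ck_upto (Suc k) \<Omega> T f"
    and h: "\<And>t. (h has_real_derivative h' t) (at t)"
    and "Ck_upto k \<Omega> T (\<lambda>x. h' (f x))"
  shows "Ck_upto (Suc k) \<Omega> T (\<lambda>x. h (f x))"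
proof (rule Ck_upto_SucI[OF assms(1)])
  have "continuous_on UNIV h"
    using h by (meson DERIV_isCont continuous_at_imp_continuous_on)
  then show "Ck_upto 0 \<Omega> T (\<lambda>x. h (f x))"
    by (rule Ck_upto_0_compose[OF Ck_upto_0[OF assms(2)]])
  show "Ck_upto k \<Omega> T (\<lambda>x. h' (f x) * partial_deriv i f x)" for i
    using assms by (intro Ck_upto_mult) auto
  fix x assume "x \<in> \<Omega>"
  then have "f differentiable (at x)" using assms(2) by auto
  then show "(\<lambda>x. h (f x)) differentiable (at x)"
    "\<And>i. partial_deriv i (\<lambda>x. h (f x)) x = h' (f x) * partial_deriv i f x"
    using has_derivative_compose_real[OF _ h] partial_deriv_compose[OF _ h]
    by (auto intro: differentiableI)
qed

section \<open>A smooth approximation of the positive part\<close>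

definition logistic :: "real \<Rightarrow> real" where "logistic t = 1 / (1 + exp (- t))"

lemma logistic_pos: "0 < logistic t" and logistic_less_1: "logistic t < 1"
  by (simp_all add: logistic_def add_pos_pos)

lemma logistic_abs_le_1: "\<bar>logistic t\<bar> \<le> 1"
  using logistic_pos[of t] logistic_less_1[of t] by simp

lemma DERIV_logistic: "(logistic has_real_derivative logistic t * (1 - logistic t)) (at t)"
proof -
  have "1 + exp (-t) \<noteq> 0" by (smt (verit) exp_gt_zero)
  then show ?thesis unfolding logistic_def
    by (auto intro!: derivative_eq_intros simp: field_simps power2_eq_square)
qed

text \<open>
  The softplus function at scale \<^term>\<open>k\<close>, shifted so that it vanishes at 0; without the shift,
  composing with it would destroy compact support.
\<close>

definition softplus :: "real \<Rightarrow> real \<Rightarrow> real" where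
  "softplus k t = (ln (1 + exp (k * t)) - ln 2) / k"

lemma DERIV_softplus:
  assumes "k > 0"
  shows "(softplus k has_real_derivative logistic (k * t)) (at t)"
proof -
  have "1 + exp (k*t) > 0" by (simp add: add_pos_pos)
  then show ?thesis unfolding softplus_def using assms
    by (auto intro!: derivative_eq_intros simp: logistic_def exp_minus divide_simps add_pos_pos)
qed

lemma softplus_0 [simp]: "softplus k 0 = 0"
  by (simp add: softplus_def)

lemma softplus_approx:
  assumes "k > 0"
  shows "\<bar>max t 0 - softplus k t\<bar> \<le> 1 / k"
proof -
  have p: "1 + exp (k*t) > 0" by (simp add: add_pos_pos)
  have ln2: "0 < ln (2::real)" "ln 2 \<le> (1::real)" using ln_le_minus_one[of 2] by simp_all
  have "\<bar>max (k*t) 0 - (ln (1 + exp (k*t)) - ln 2)\<bar> \<le> 1"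
  proof (cases "t \<le> 0")
    case True
    then have kt: "k*t \<le> 0" using assms by (simp add: mult_nonneg_nonpos)
    then have "ln (1 + exp (k*t)) \<le> ln 2" using p by (subst ln_le_cancel_iff) auto
    moreover have "0 \<le> ln (1 + exp (k*t))" by simp
    ultimately show ?thesis using kt ln2 unfolding max_absorb2[OF kt] by linarith
  next
    case False
    then have kt: "0 \<le> k*t" using assms by simp
    then have "1 + exp (k*t) \<le> 2 * exp (k*t)" by simp
    then have "ln (1 + exp (k*t)) \<le> ln (2 * exp (k*t))" using p by (subst ln_le_cancel_iff) auto
    moreover have "ln (exp (k*t)) \<le> ln (1 + exp (k*t))" using p by (subst ln_le_cancel_iff) auto
    ultimately show ?thesis using kt ln2 by (simp add: ln_mult)
  qed
  moreover have "max (k * t) 0 = k * max t 0"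
    using assms max_mult_distrib_left[of k t 0] by simp
  then have "max t 0 - softplus k t = (max (k * t) 0 - (ln (1 + exp (k * t)) - ln 2)) / k"
    using assms by (simp add: softplus_def diff_divide_distrib)
  ultimately show ?thesis using assms by (simp only: abs_divide abs_of_pos divide_right_mono[OF _ less_imp_le])
qed

lemma lipschitz_of_DERIV:
  fixes h :: "real \<Rightarrow> real"
  assumes "\<And>t. (h has_real_derivative h' t) (at t)" "\<And>t. \<bar>h' t\<bar> \<le> L"
  shows "\<bar>h s - h t\<bar> \<le> L * \<bar>s - t\<bar>"
  using field_differentiable_bound[of UNIV h h' L t s] assms
  by (simp add: abs_minus_commute)

lemma softplus_lipschitz:
  assumes "k > 0"
  shows "\<bar>softplus k s - softplus k t\<bar> \<le> \<bar>s - t\<bar>"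
  using lipschitz_of_DERIV[OF DERIV_softplus[OF assms] logistic_abs_le_1, of s t] by simp

lemma logistic_lipschitz: "\<bar>logistic s - logistic t\<bar> \<le> \<bar>s - t\<bar>"
proof -
  have "\<bar>logistic t * (1 - logistic t)\<bar> \<le> 1" for t
    using logistic_pos[of t] logistic_less_1[of t] by (simp add: abs_mult mult_le_one)
  from lipschitz_of_DERIV[OF DERIV_logistic this, of s t] show ?thesis by simp
qed

text \<open>
  The limit exists at 0 as well, where it is \<open>1 / 2\<close>. This pointwise convergence everywhere is
  what makes \<open>(1 + sgn u) / 2\<close> the right factor for the gradient of the positive part.
\<close>

lemma logistic_tendsto_sgn:
  "(\<lambda>n. logistic (real n * t)) \<longlonglongrightarrow> (1 + sgn t) / 2"
proof -
  consider "t > 0" | "t = 0" | "t < 0" by linarith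
  then show ?thesis
  proof cases
    case 1
    then have "(\<lambda>n. exp (- (real n * t))) \<longlonglongrightarrow> 0"
      by (intro filterlim_compose[OF exp_at_bot])
         (auto simp: filterlim_uminus_at_bot mult.commute intro!: filterlim_tendsto_pos_mult_at_top tendsto_const filterlim_real_sequentially)
    then have "(\<lambda>n. 1 / (1 + exp (- (real n * t)))) \<longlonglongrightarrow> 1 / (1 + 0)" by (intro tendsto_intros) auto
    then show ?thesis using 1 by (simp add: logistic_def)
  next
    case 2
    then show ?thesis by (simp add: logistic_def)
  next
    case 3
    then have "(\<lambda>n. exp (real n * t)) \<longlonglongrightarrow> 0"
      by (intro filterlim_compose[OF exp_at_bot])
         (auto simp: mult.commute intro!: filterlim_tendsto_neg_mult_at_bot tendsto_const filterlim_real_sequentially)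
    then have "(\<lambda>n. exp (real n * t) / (1 + exp (real n * t))) \<longlonglongrightarrow> 0 / (1 + 0)" by (intro tendsto_intros) auto
    then show ?thesis using 3 by (simp add: logistic_def exp_minus field_simps)
  qed
qed

text \<open>
  Since \<open>\<sigma>' = \<sigma> (1 - \<sigma>)\<close>, regularity of \<open>\<sigma> \<circ> f\<close> of order \<open>k\<close> yields regularity of its
  partial derivatives of order \<open>k\<close>, hence of \<open>\<sigma> \<circ> f\<close> of order \<open>k + 1\<close>.
\<close>

lemma Ck_upto_logistic:
  assumes "open \<Omega>" "Ck_upto k \<Omega> T f"
  shows "Ck_upto k \<Omega> T (\<lambda>x. logistic (f x))"
  using assms(2)
proof (induction k)
  case 0
  have "continuous_on UNIV logistic"
    using DERIV_logistic by (meson DERIV_isCont continuous_at_imp_continuous_on)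
  then show ?case using 0 by (rule Ck_upto_0_compose[rotated])
next
  case (Suc k)
  have y: "Ck_upto k \<Omega> T (\<lambda>x. logistic (f x))" using Suc Ck_upto_Suc_imp by blast
  have "Ck_upto k \<Omega> T (\<lambda>x. logistic (f x) * (1 + (-1) * logistic (f x)))"
    by (intro Ck_upto_mult Ck_upto_add Ck_upto_const y assms(1))
  then show ?case
    by (intro Ck_upto_Suc_compose[OF assms(1) Suc.prems DERIV_logistic]) simp
qed

lemma Ck_upto_softplus:
  assumes "open \<Omega>" "c > 0" "Ck_upto k \<Omega> T f"
  shows "Ck_upto k \<Omega> T (\<lambda>x. softplus c (f x))"
proof (cases k)
  case 0
  have "continuous_on UNIV (softplus c)"
    using DERIV_softplus[OF assms(2)] by (meson DERIV_isCont continuous_at_imp_continuous_on)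
  then show ?thesis using 0 assms(3) Ck_upto_0_compose by metis
next
  case (Suc j)
  have "Ck_upto j \<Omega> T (\<lambda>x. logistic (c * f x))"
    using Ck_upto_Suc_imp[OF assms(3)[unfolded Suc]]
    by (intro Ck_upto_logistic Ck_upto_mult Ck_upto_const assms(1)) auto
  with assms(3) show ?thesis
    unfolding Suc by (rule Ck_upto_Suc_compose[OF assms(1) _ DERIV_softplus[OF assms(2)]])
qed

section \<open>Test functions\<close>

lemma C0_infinity_subsupport:
  assumes "f \<in> C0_infinity \<Omega> T" "\<And>k. Ck_upto k \<Omega> T g" "\<And>x. x \<in> \<Omega> \<Longrightarrow> f x = 0 \<Longrightarrow> g x = 0"
  shows "g \<in> C0_infinity \<Omega> T"
proof -
  have "{x\<in>\<Omega>. g x \<noteq> 0} \<subseteq> {x\<in>\<Omega>. f x \<noteq> 0}" using assms(3) by auto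
  then have *: "closure {x\<in>\<Omega>. g x \<noteq> 0} \<subseteq> closure {x\<in>\<Omega>. f x \<noteq> 0}" by (rule closure_mono)
  then have "compact (closure {x\<in>\<Omega>. g x \<noteq> 0})"
    using assms(1) compact_Int_closed[of "closure {x\<in>\<Omega>. f x \<noteq> 0}" "closure {x\<in>\<Omega>. g x \<noteq> 0}"]
    by (simp add: C0_infinity_def Int_absorb1)
  then show ?thesis using assms * by (auto simp: C0_infinity_def)
qed

lemma C0_infinity_differentiable:
  assumes "f \<in> C0_infinity \<Omega> T" "x \<in> \<Omega>"
  shows "f differentiable (at x)"
proof -
  have "Ck_upto (Suc 0) \<Omega> T f" using assms(1) by (auto simp only: C0_infinity_def)
  then show ?thesis using assms(2) by simp
qed

text \<open>
  The partial derivatives are bounded on the compact support because they extend continuously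
  to it, and they vanish near every point outside the support.
\<close>

lemma C0_infinity_bounded_grad:
  assumes "open \<Omega>" "f \<in> C0_infinity \<Omega> T"
  obtains B where "\<And>x. x \<in> \<Omega> \<Longrightarrow> norm (grad f x) \<le> B"
proof -
  let ?K = "closure {x\<in>\<Omega>. f x \<noteq> 0}"
  have "\<exists>B\<ge>0. \<forall>x\<in>\<Omega>. \<bar>partial_deriv i f x\<bar> \<le> B" for i
  proof -
    have "Ck_upto (Suc 0) \<Omega> T f" using assms by (auto simp only: C0_infinity_def)
    then have "Ck_upto 0 \<Omega> T (partial_deriv i f)" by (simp only: Ck_upto.simps(2))
    then obtain g where g: "continuous_on T g" "\<forall>x\<in>\<Omega>. g x = partial_deriv i f x" by auto
    have "compact ?K" "?K \<subseteq> T" using assms by (auto simp only: C0_infinity_def)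
    then have "bounded (g ` ?K)"
      using g(1) by (meson compact_continuous_image compact_imp_bounded continuous_on_subset)
    then obtain B where B: "\<And>x. x \<in> ?K \<Longrightarrow> \<bar>g x\<bar> \<le> B" by (auto simp: bounded_iff)
    have "\<bar>partial_deriv i f x\<bar> \<le> max B 0" if "x \<in> \<Omega>" for x
    proof (cases "x \<in> ?K")
      case True
      then show ?thesis using B[OF True] g that by auto
    next
      case False
      have "partial_deriv i f x = partial_deriv i (\<lambda>x. 0) x"
      proof (rule differentiable_cong_open(2))
        show "open (\<Omega> - ?K)" using assms(1) by blast
        show "x \<in> \<Omega> - ?K" using False that by blast
        show "f y = 0" if "y \<in> \<Omega> - ?K" for y
          using that closure_subset[of "{x\<in>\<Omega>. f x \<noteq> 0}"] by auto
      qed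
      then show ?thesis by (simp add: partial_deriv_def)
    qed
    then show ?thesis by (intro exI[of _ "max B 0"]) auto
  qed
  then obtain B where B: "\<And>i x. x \<in> \<Omega> \<Longrightarrow> \<bar>partial_deriv i f x\<bar> \<le> B i" by metis
  have "norm (grad f x) \<le> (\<Sum>i\<in>UNIV. B i)" if "x \<in> \<Omega>" for x
  proof -
    have "norm (grad f x) \<le> (\<Sum>i\<in>UNIV. \<bar>grad f x $ i\<bar>)" by (rule norm_le_l1_cart)
    also have "\<dots> \<le> (\<Sum>i\<in>UNIV. B i)" using B[OF that] by (intro sum_mono) (simp add: grad_def)
    finally show ?thesis .
  qed
  then show thesis using that by blast
qed

lemma Ck_upto_0_continuous_on:
  assumes "Ck_upto 0 \<Omega> T f" "\<Omega> \<subseteq> T"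
  shows "continuous_on \<Omega> f"
proof -
  obtain g where g: "continuous_on T g" "\<forall>x\<in>\<Omega>. g x = f x" using assms(1) by auto
  have "continuous_on \<Omega> g" using g(1) assms(2) by (rule continuous_on_subset)
  then show ?thesis using g(2) by (simp cong: continuous_on_cong)
qed

lemma C0_infinity_measurable:
  assumes "open \<Omega>" "\<Omega> \<subseteq> T" "f \<in> C0_infinity \<Omega> T"
  shows "f \<in> borel_measurable (lebesgue_on \<Omega>)" "grad f \<in> borel_measurable (lebesgue_on \<Omega>)"
proof -
  have f: "Ck_upto (Suc 0) \<Omega> T f" using assms(3) by (auto simp only: C0_infinity_def)
  have "continuous_on \<Omega> f"
    using Ck_upto_0[OF f] assms(2) by (rule Ck_upto_0_continuous_on)
  moreover have "continuous_on \<Omega> (partial_deriv i f)" for i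
  proof (rule Ck_upto_0_continuous_on[OF _ assms(2)])
    show "Ck_upto 0 \<Omega> T (partial_deriv i f)" using f by (simp only: Ck_upto.simps(2))
  qed
  then have "continuous_on \<Omega> (grad f)"
    unfolding grad_def by (intro continuous_on_vec_lambda)
  ultimately show "f \<in> borel_measurable (lebesgue_on \<Omega>)" "grad f \<in> borel_measurable (lebesgue_on \<Omega>)"
    using assms(1) by (simp_all add: continuous_imp_measurable_on_sets_lebesgue)
qed

lemma C0_infinity_softplus:
  assumes "open \<Omega>" "c > 0" "f \<in> C0_infinity \<Omega> T"
  shows "(\<lambda>x. softplus c (f x)) \<in> C0_infinity \<Omega> T"
    and "x \<in> \<Omega> \<Longrightarrow> grad (\<lambda>x. softplus c (f x)) x = logistic (c * f x) *\<^sub>R grad f x"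
proof -
  show "(\<lambda>x. softplus c (f x)) \<in> C0_infinity \<Omega> T"
  proof (rule C0_infinity_subsupport[OF assms(3)])
    show "Ck_upto k \<Omega> T (\<lambda>x. softplus c (f x))" for k
      using assms by (intro Ck_upto_softplus) (auto simp: C0_infinity_def)
  qed simp
  show "grad (\<lambda>x. softplus c (f x)) x = logistic (c * f x) *\<^sub>R grad f x" if "x \<in> \<Omega>"
    using partial_deriv_compose[OF C0_infinity_differentiable[OF assms(3) that] DERIV_softplus[OF assms(2)]]
    by (simp add: grad_def vec_eq_iff)
qed

lemma C0_infinity_uminus:
  assumes "open \<Omega>" "f \<in> C0_infinity \<Omega> T"
  shows "(\<lambda>x. - f x) \<in> C0_infinity \<Omega> T"
    and "x \<in> \<Omega> \<Longrightarrow> grad (\<lambda>x. - f x) x = - grad f x"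
proof -
  show "(\<lambda>x. - f x) \<in> C0_infinity \<Omega> T"
  proof (rule C0_infinity_subsupport[OF assms(2)])
    have "Ck_upto k \<Omega> T (\<lambda>x. (-1) * f x)" for k
      using assms by (intro Ck_upto_mult Ck_upto_const) (auto simp: C0_infinity_def)
    then show "Ck_upto k \<Omega> T (\<lambda>x. - f x)" for k by simp
  qed simp
  have "(uminus has_real_derivative -1) (at t)" for t :: real
    by (auto intro!: derivative_eq_intros)
  then show "grad (\<lambda>x. - f x) x = - grad f x" if "x \<in> \<Omega>"
    using partial_deriv_compose[OF C0_infinity_differentiable[OF assms(2) that], of uminus "-1"]
    by (simp add: grad_def vec_eq_iff)
qed

section \<open>Positive parts in the completion\<close>

lemma weight_function_measurable:
  assumes "open \<Omega>" "weight_function \<Omega> w"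
  shows "w \<in> borel_measurable (lebesgue_on \<Omega>)"
  using assms by (auto simp: weight_function_def intro: continuous_imp_measurable_on_sets_lebesgue)

lemma weight_function_nn_integral:
  assumes "open \<Omega>" "weight_function \<Omega> w"
  shows "(\<integral>\<^sup>+x. ennreal (w x) \<partial>lebesgue_on \<Omega>) < \<infinity>"
proof -
  have "integrable (lebesgue_on \<Omega>) w"
    using assms by (simp add: weight_function_def set_integrable_def integrable_restrict_space)
  then have "(\<integral>\<^sup>+x. ennreal (norm (w x)) \<partial>lebesgue_on \<Omega>) < \<infinity>"
    by (simp add: integrable_iff_bounded)
  moreover have "(\<integral>\<^sup>+x. ennreal (norm (w x)) \<partial>lebesgue_on \<Omega>) = (\<integral>\<^sup>+x. ennreal (w x) \<partial>lebesgue_on \<Omega>)"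
    using assms(2) by (intro nn_integral_cong) (auto simp: weight_function_def less_imp_le)
  ultimately show ?thesis by simp
qed

lemma norm_sum2_sq: "(norm (a + b :: 'a :: real_normed_vector))\<^sup>2 \<le> 2 * (norm a)\<^sup>2 + 2 * (norm b)\<^sup>2"
proof -
  have "(norm (a + b))\<^sup>2 \<le> (norm a + norm b)\<^sup>2" by (intro power_mono norm_triangle_ineq) simp
  also have "\<dots> \<le> 2 * (norm a)\<^sup>2 + 2 * (norm b)\<^sup>2"
    using sum_squares_bound[of "norm a" "norm b"] by (simp add: power2_sum)
  finally show ?thesis .
qed

text \<open>
  A test function has bounded gradient and the weight is integrable; an element of the
  completion is at finite distance from some test function. The finiteness provides the
  dominating function for the passage to the limit below.
\<close>

lemma H1_completion_gradient_finite:
  assumes "open \<Omega>" "\<Omega> \<subseteq> T" "weight_function \<Omega> w0" "weight_function \<Omega> w1"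
    and uG: "(u, G) \<in> H1_completion \<Omega> w0 w1 (C0_infinity \<Omega> T)"
  shows "(\<integral>\<^sup>+x. ennreal ((norm (G x))\<^sup>2 * w1 x) \<partial>lebesgue_on \<Omega>) < \<infinity>"
proof -
  let ?M = "lebesgue_on \<Omega>"
  have [measurable]: "u \<in> borel_measurable ?M" "G \<in> borel_measurable ?M"
    using uG by (auto simp: H1_completion_def)
  note [measurable] = weight_function_measurable[OF assms(1,3)] weight_function_measurable[OF assms(1,4)]
  have w: "w0 x > 0" "w1 x > 0" if "x \<in> \<Omega>" for x using that assms by (auto simp: weight_function_def)
  obtain \<phi> where \<phi>: "\<phi> \<in> C0_infinity \<Omega> T"
    and less: "H1_norm_sq \<Omega> w0 w1 (\<lambda>x. u x - \<phi> x) (\<lambda>x. G x - grad \<phi> x) < ennreal 1"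
    using uG unfolding H1_completion_def by (auto dest!: spec[of _ 1])
  note [measurable] = C0_infinity_measurable[OF assms(1,2) \<phi>]
  obtain B where B: "\<And>x. x \<in> \<Omega> \<Longrightarrow> norm (grad \<phi> x) \<le> B"
    using C0_infinity_bounded_grad[OF assms(1) \<phi>] by blast
  let ?f = "\<lambda>x. (norm (G x - grad \<phi> x))\<^sup>2 * w1 x + \<bar>u x - \<phi> x\<bar>\<^sup>2 * w0 x"
  have "(\<integral>\<^sup>+x. ennreal ((norm (G x))\<^sup>2 * w1 x) \<partial>?M)
      \<le> (\<integral>\<^sup>+x. 2 * ennreal (?f x) + ennreal (2 * B\<^sup>2) * ennreal (w1 x) \<partial>?M)"
  proof (rule nn_integral_mono)
    fix x assume "x \<in> space ?M"
    then have x: "x \<in> \<Omega>" by simp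
    have "(norm (grad \<phi> x))\<^sup>2 \<le> B\<^sup>2" using B[OF x] by (intro power_mono) auto
    then have "(norm (G x))\<^sup>2 \<le> 2 * (norm (G x - grad \<phi> x))\<^sup>2 + 2 * B\<^sup>2"
      using norm_sum2_sq[of "G x - grad \<phi> x" "grad \<phi> x"] by simp
    then have "(norm (G x))\<^sup>2 * w1 x \<le> (2 * (norm (G x - grad \<phi> x))\<^sup>2 + 2 * B\<^sup>2) * w1 x"
      using w[OF x] by (intro mult_right_mono) auto
    also have "\<dots> \<le> 2 * ?f x + 2 * B\<^sup>2 * w1 x" using w[OF x] by (simp add: algebra_simps)
    finally have "ennreal ((norm (G x))\<^sup>2 * w1 x) \<le> ennreal (2 * ?f x + 2 * B\<^sup>2 * w1 x)"
      by (rule ennreal_leI)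
    also have "\<dots> = 2 * ennreal (?f x) + ennreal (2 * B\<^sup>2) * ennreal (w1 x)"
      using w[OF x] by (simp add: ennreal_plus[symmetric] ennreal_mult'[symmetric]
          del: ennreal_plus flip: ennreal_numeral)
    finally show "ennreal ((norm (G x))\<^sup>2 * w1 x) \<le> \<dots>" .
  qed
  also have "\<dots> = 2 * (\<integral>\<^sup>+x. ennreal (?f x) \<partial>?M) + ennreal (2 * B\<^sup>2) * (\<integral>\<^sup>+x. ennreal (w1 x) \<partial>?M)"
    by (simp add: nn_integral_add nn_integral_cmult)
  also have "\<dots> < \<infinity>"
  proof -
    have "(\<integral>\<^sup>+x. ennreal (?f x) \<partial>?M) < \<infinity>"
      using less unfolding H1_norm_sq_def by (rule order.strict_trans) simp
    then show ?thesis
      using weight_function_nn_integral[OF assms(1,4)] by (simp add: ennreal_mult_less_top)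
  qed
  finally show ?thesis .
qed

lemma logistic_scaled_diff_sq:
  assumes "k \<ge> 0"
  shows "(logistic (k * s) - logistic (k * t))\<^sup>2 \<le> 1"
    and "(logistic (k * s) - logistic (k * t))\<^sup>2 \<le> k\<^sup>2 * \<bar>s - t\<bar>\<^sup>2"
proof -
  have "\<bar>logistic (k * s) - logistic (k * t)\<bar> \<le> 1"
    using logistic_pos[of "k * s"] logistic_less_1[of "k * s"] logistic_pos[of "k * t"] logistic_less_1[of "k * t"] by simp
  then show "(logistic (k * s) - logistic (k * t))\<^sup>2 \<le> 1" by (simp add: abs_square_le_1)
  have "\<bar>logistic (k * s) - logistic (k * t)\<bar> \<le> k * \<bar>s - t\<bar>"
    using logistic_lipschitz[of "k * s" "k * t"] assms by (simp add: abs_mult flip: right_diff_distrib)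
  then show "(logistic (k * s) - logistic (k * t))\<^sup>2 \<le> k\<^sup>2 * \<bar>s - t\<bar>\<^sup>2"
    using power_mono[of "\<bar>logistic (k * s) - logistic (k * t)\<bar>" "k * \<bar>s - t\<bar>" 2] by (simp add: power_mult_distrib)
qed

lemma norm_sum3_sq: "(norm (a + b + c :: 'a :: real_normed_vector))\<^sup>2 \<le> 3 * ((norm a)\<^sup>2 + (norm b)\<^sup>2 + (norm c)\<^sup>2)"
proof -
  have "norm (a + b + c) \<le> norm a + norm b + norm c" by (meson norm_add_rule_thm norm_triangle_ineq order_refl)
  then have "(norm (a + b + c))\<^sup>2 \<le> (norm a + norm b + norm c)\<^sup>2" by (intro power_mono) auto
  also have "\<dots> \<le> 3 * ((norm a)\<^sup>2 + (norm b)\<^sup>2 + (norm c)\<^sup>2)"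
    using sum_squares_bound[of "norm a" "norm b"] sum_squares_bound[of "norm a" "norm c"]
      sum_squares_bound[of "norm b" "norm c"]
    by (simp add: power2_eq_square algebra_simps)
  finally show ?thesis .
qed

text \<open>
  The part of the pointwise error that does not depend on the approximating test function. Here
  \<open>a\<close> is the value of the weight of the function, \<open>t\<close> the value of the function and \<open>E\<close> its
  gradient energy density. The first summand stems from the distance of softplus
  to the positive part, the square from that of its derivative to \<open>(1 + sgn t) / 2\<close>, and the
  conditional from the region of large energy density.
\<close>

definition pos_part_error :: "real \<Rightarrow> real \<Rightarrow> real \<Rightarrow> real \<Rightarrow> real" where
  "pos_part_error k a t E = 2 / k\<^sup>2 * a +
     3 * (((1 + sgn t) / 2 - logistic (k * t))\<^sup>2 + (if k * a < E then 1 else 0)) * E"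

lemma pos_part_error_bound:
  assumes "k \<ge> 1" "a \<ge> 0" "E \<ge> 0"
  shows "0 \<le> pos_part_error k a t E" "pos_part_error k a t E \<le> 2 * a + 6 * E"
proof -
  show "0 \<le> pos_part_error k a t E" using assms by (auto simp: pos_part_error_def)
  have "\<bar>(1 + sgn t) / 2 - logistic (k * t)\<bar> \<le> 1"
    using logistic_pos[of "k * t"] logistic_less_1[of "k * t"] by (auto simp: sgn_if)
  then have "((1 + sgn t) / 2 - logistic (k * t))\<^sup>2 \<le> 1" by (simp only: abs_square_le_1)
  then have "3 * (((1 + sgn t) / 2 - logistic (k * t))\<^sup>2 + (if k * a < E then 1 else 0)) * E \<le> 6 * E"
    using assms by (intro mult_right_mono) auto
  moreover have "2 / k\<^sup>2 * a \<le> 2 * a" using assms by (intro mult_right_mono) (auto simp: divide_simps)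
  ultimately show "pos_part_error k a t E \<le> 2 * a + 6 * E" by (simp add: pos_part_error_def)
qed

lemma pos_part_error_tendsto_0:
  assumes "a > 0"
  shows "(\<lambda>n. pos_part_error (real (Suc n)) a t E) \<longlonglongrightarrow> 0"
proof (rule LIMSEQ_Suc)
  have "(\<lambda>n. 1 / real n) \<longlonglongrightarrow> 0" by (rule lim_1_over_n)
  then have "(\<lambda>n. 2 * (1 / real n)\<^sup>2 * a) \<longlonglongrightarrow> 2 * 0\<^sup>2 * a" by (intro tendsto_intros)
  then have 1: "(\<lambda>n. 2 / (real n)\<^sup>2 * a) \<longlonglongrightarrow> 0" by (simp add: power_divide)
  have "\<forall>\<^sub>F n in sequentially. E / a < real n"
    using filterlim_real_sequentially by (auto simp: filterlim_at_top_dense)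
  then have "\<forall>\<^sub>F n in sequentially. (if real n * a < E then 1 else 0 :: real) = 0"
    by eventually_elim (use assms in \<open>auto simp: field_simps\<close>)
  then have 2: "(\<lambda>n. if real n * a < E then 1 else 0 :: real) \<longlonglongrightarrow> 0" by (rule tendsto_eventually)
  have 3: "(\<lambda>n. (1 + sgn t) / 2 - logistic (real n * t)) \<longlonglongrightarrow> (1 + sgn t) / 2 - (1 + sgn t) / 2"
    by (intro tendsto_diff tendsto_const logistic_tendsto_sgn)
  have "(\<lambda>n. pos_part_error (real n) a t E) \<longlonglongrightarrow>
      0 + 3 * (((1 + sgn t) / 2 - (1 + sgn t) / 2)\<^sup>2 + 0) * E"
    unfolding pos_part_error_def by (intro tendsto_add tendsto_mult tendsto_power tendsto_const 1 2 3)
  then show "(\<lambda>n. pos_part_error (real n) a t E) \<longlonglongrightarrow> 0" by simp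
qed

text \<open>
  Here \<open>s\<close>, \<open>G\<close> are values of the given function and its gradient, \<open>t\<close>, \<open>H\<close> those of the test
  function, and \<open>a\<close>, \<open>b\<close> those of the weights. The gradient error is split as
  \<open>((1 + sgn s) / 2 - \<sigma> (k s)) G + (\<sigma> (k s) - \<sigma> (k t)) G + \<sigma> (k t) (G - H)\<close>. The
  middle term is the reason for the cut in \<^const>\<open>pos_part_error\<close>: where \<open>\<bar>G\<bar>\<^sup>2 b \<le> k a\<close>, the
  Lipschitz bound of \<open>\<sigma>\<close> gives the factor \<open>k\<^sup>2 k = k ^ 3\<close> in front of \<open>\<bar>s - t\<bar>\<^sup>2 a\<close>.
\<close>

lemma softplus_pointwise:
  fixes G H :: "'a :: real_normed_vector"
  assumes k: "k \<ge> 1" and a: "a > 0" and b: "b > 0"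
  shows "(norm (((1 + sgn s) / 2) *\<^sub>R G - logistic (k * t) *\<^sub>R H))\<^sup>2 * b + \<bar>max s 0 - softplus k t\<bar>\<^sup>2 * a
    \<le> pos_part_error k a s ((norm G)\<^sup>2 * b) + (3 * k ^ 3 + 5) * ((norm (G - H))\<^sup>2 * b + \<bar>s - t\<bar>\<^sup>2 * a)"
proof -
  let ?D = "(1 + sgn s) / 2 - logistic (k * s)" and ?L = "logistic (k * s) - logistic (k * t)"
  let ?E = "(norm G)\<^sup>2 * b"
  have "((1 + sgn s) / 2) *\<^sub>R G - logistic (k * t) *\<^sub>R H = ?D *\<^sub>R G + ?L *\<^sub>R G + logistic (k * t) *\<^sub>R (G - H)"
    by (simp add: algebra_simps)
  then have "(norm (((1 + sgn s) / 2) *\<^sub>R G - logistic (k * t) *\<^sub>R H))\<^sup>2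
      \<le> 3 * (?D\<^sup>2 * (norm G)\<^sup>2 + ?L\<^sup>2 * (norm G)\<^sup>2 + (logistic (k * t))\<^sup>2 * (norm (G - H))\<^sup>2)"
    using norm_sum3_sq[of "?D *\<^sub>R G" "?L *\<^sub>R G" "logistic (k * t) *\<^sub>R (G - H)"]
    by (simp add: power_mult_distrib)
  also have "\<dots> \<le> 3 * (?D\<^sup>2 * (norm G)\<^sup>2 + ?L\<^sup>2 * (norm G)\<^sup>2 + 1 * (norm (G - H))\<^sup>2)"
    using logistic_pos[of "k * t"] logistic_less_1[of "k * t"]
    by (intro mult_left_mono add_left_mono mult_right_mono) (auto simp: abs_square_le_1)
  finally have "(norm (((1 + sgn s) / 2) *\<^sub>R G - logistic (k * t) *\<^sub>R H))\<^sup>2 * b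
      \<le> 3 * (?D\<^sup>2 * (norm G)\<^sup>2 + ?L\<^sup>2 * (norm G)\<^sup>2 + 1 * (norm (G - H))\<^sup>2) * b"
    using b by (intro mult_right_mono) auto
  also have "\<dots> = 3 * ?D\<^sup>2 * ?E + 3 * (?L\<^sup>2 * ?E) + 3 * ((norm (G - H))\<^sup>2 * b)"
    by (simp add: algebra_simps)
  finally have grad: "(norm (((1 + sgn s) / 2) *\<^sub>R G - logistic (k * t) *\<^sub>R H))\<^sup>2 * b
      \<le> 3 * ?D\<^sup>2 * ?E + 3 * (?L\<^sup>2 * ?E) + 3 * ((norm (G - H))\<^sup>2 * b)" .
  have E: "?E \<ge> 0" and k0: "k \<ge> 0" using b k by simp_all
  have cut: "?L\<^sup>2 * ?E \<le> (if k * a < ?E then 1 else 0) * ?E + k ^ 3 * (\<bar>s - t\<bar>\<^sup>2 * a)"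
  proof (cases "k * a < ?E")
    case True
    have "?L\<^sup>2 * ?E \<le> 1 * ?E" using logistic_scaled_diff_sq(1)[of k s t] k E by (intro mult_right_mono) auto
    moreover have "0 \<le> k ^ 3 * (\<bar>s - t\<bar>\<^sup>2 * a)" using k a by simp
    ultimately show ?thesis using True by simp
  next
    case False
    then have "?E \<le> k * a" by simp
    with logistic_scaled_diff_sq(2)[OF k0, of s t] have "?L\<^sup>2 * ?E \<le> (k\<^sup>2 * \<bar>s - t\<bar>\<^sup>2) * (k * a)"
      by (rule mult_mono) (use E in auto)
    then show ?thesis using False by (simp add: power2_eq_square power3_eq_cube mult_ac)
  qed
  have "\<bar>max s 0 - softplus k t\<bar> \<le> 1 / k + \<bar>s - t\<bar>"
    using softplus_approx[of k s] softplus_lipschitz[of k s t] k by linarith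
  then have "\<bar>max s 0 - softplus k t\<bar>\<^sup>2 \<le> (1 / k + \<bar>s - t\<bar>)\<^sup>2" by (intro power_mono) auto
  also have "\<dots> \<le> 2 / k\<^sup>2 + 2 * \<bar>s - t\<bar>\<^sup>2"
    using sum_squares_bound[of "1/k" "\<bar>s - t\<bar>"] by (simp add: power2_sum power_divide)
  finally have "\<bar>max s 0 - softplus k t\<bar>\<^sup>2 * a \<le> (2 / k\<^sup>2 + 2 * \<bar>s - t\<bar>\<^sup>2) * a"
    using a by (intro mult_right_mono) auto
  then have val: "\<bar>max s 0 - softplus k t\<bar>\<^sup>2 * a \<le> 2 / k\<^sup>2 * a + 2 * (\<bar>s - t\<bar>\<^sup>2 * a)"
    by (simp add: algebra_simps)
  define c where "c = (if k * a < ?E then 1 else 0 :: real)"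
  define Z where "Z = (norm (G - H))\<^sup>2 * b"
  define W where "W = \<bar>s - t\<bar>\<^sup>2 * a"
  have "Z \<ge> 0" "W \<ge> 0" "k ^ 3 * Z \<ge> 0" using k0 a b by (simp_all add: Z_def W_def)
  moreover have "pos_part_error k a s ?E + (3 * k ^ 3 + 5) * (Z + W)
      = 2 / k\<^sup>2 * a + 3 * ?D\<^sup>2 * ?E + 3 * (c * ?E) + 3 * (k ^ 3 * Z) + 3 * (k ^ 3 * W) + 5 * Z + 5 * W"
    unfolding pos_part_error_def c_def[symmetric] by (simp add: algebra_simps)
  ultimately show ?thesis
    using grad cut val unfolding c_def[symmetric] Z_def[symmetric] W_def[symmetric] by linarith
qed

text \<open>
  The scale is fixed first, by dominated convergence of the error that is independent of the
  test function; the test function is chosen afterwards, depending on the scale. The gradient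
  found for the positive part is the same for every \<^term>\<open>T\<close>, which \<open>H1_0_pos_part\<close> exploits.
\<close>

lemma H1_completion_pos_part:
  assumes "open \<Omega>" "\<Omega> \<subseteq> T" "weight_function \<Omega> w0" "weight_function \<Omega> w1"
    and uG: "(u, G) \<in> H1_completion \<Omega> w0 w1 (C0_infinity \<Omega> T)"
  shows "(\<lambda>x. max (u x) 0, \<lambda>x. ((1 + sgn (u x)) / 2) *\<^sub>R G x) \<in> H1_completion \<Omega> w0 w1 (C0_infinity \<Omega> T)"
proof -
  let ?M = "lebesgue_on \<Omega>"
  have [measurable]: "u \<in> borel_measurable ?M" "G \<in> borel_measurable ?M"
    using uG by (auto simp: H1_completion_def)
  note [measurable] = weight_function_measurable[OF assms(1,3)] weight_function_measurable[OF assms(1,4)]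
  have w: "w0 x > 0" "w1 x > 0" if "x \<in> \<Omega>" for x using that assms by (auto simp: weight_function_def)
  \<comment> \<open>The shift by one makes every scale at least 1, where the error is dominated.\<close>
  define R where "R n x = pos_part_error (real (Suc n)) (w0 x) (u x) ((norm (G x))\<^sup>2 * w1 x)" for n x
  have "logistic \<in> borel_measurable borel" unfolding logistic_def by measurable
  then have [measurable]: "R n \<in> borel_measurable ?M" for n
    unfolding R_def pos_part_error_def by measurable
  have R_int: "(\<lambda>n. \<integral>\<^sup>+x. ennreal (R n x) \<partial>?M) \<longlonglongrightarrow> (\<integral>\<^sup>+x. 0 \<partial>?M)"
  proof (rule nn_integral_dominated_convergence)
    let ?w = "\<lambda>x. 2 * ennreal (w0 x) + 6 * ennreal ((norm (G x))\<^sup>2 * w1 x)"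
    show "AE x in ?M. ennreal (R n x) \<le> ?w x" for n
    proof (rule AE_I2)
      fix x assume "x \<in> space ?M"
      then have x: "x \<in> \<Omega>" by simp
      have "ennreal (R n x) \<le> ennreal (2 * w0 x + 6 * ((norm (G x))\<^sup>2 * w1 x))"
        unfolding R_def using w[OF x] by (intro ennreal_leI pos_part_error_bound) auto
      also have "\<dots> = ?w x" using w[OF x]
        by (simp add: ennreal_mult' ennreal_plus flip: ennreal_numeral)
      finally show "ennreal (R n x) \<le> ?w x" .
    qed
    show "(\<integral>\<^sup>+x. ?w x \<partial>?M) < \<infinity>"
      using weight_function_nn_integral[OF assms(1,3)] H1_completion_gradient_finite[OF assms]
      by (simp add: nn_integral_add nn_integral_cmult ennreal_mult_less_top)
    show "AE x in ?M. (\<lambda>n. ennreal (R n x)) \<longlonglongrightarrow> 0"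
    proof (rule AE_I2)
      fix x assume "x \<in> space ?M"
      then have "(\<lambda>n. R n x) \<longlonglongrightarrow> 0" unfolding R_def using w(1) by (intro pos_part_error_tendsto_0) simp
      then show "(\<lambda>n. ennreal (R n x)) \<longlonglongrightarrow> 0" using tendsto_ennrealI[of "\<lambda>n. R n x" 0] by simp
    qed
  qed auto
  have "\<exists>\<psi>\<in>C0_infinity \<Omega> T. H1_norm_sq \<Omega> w0 w1 (\<lambda>x. max (u x) 0 - \<psi> x)
      (\<lambda>x. ((1 + sgn (u x)) / 2) *\<^sub>R G x - grad \<psi> x) < ennreal e" if e: "e > 0" for e :: real
  proof -
    have "\<forall>\<^sub>F n in sequentially. (\<integral>\<^sup>+x. ennreal (R n x) \<partial>?M) < ennreal (e/2)"
      using R_int e by (intro order_tendstoD(2)) auto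
    then obtain n where n: "(\<integral>\<^sup>+x. ennreal (R n x) \<partial>?M) < ennreal (e/2)"
      using eventually_happens'[OF sequentially_bot] by blast
    define k where "k = real (Suc n)"
    define C where "C = 3 * k ^ 3 + 5"
    have k: "k \<ge> 1" by (simp add: k_def)
    then have C: "C > 0" by (simp add: C_def add_nonneg_pos)
    then obtain \<phi> where \<phi>: "\<phi> \<in> C0_infinity \<Omega> T"
      and less: "H1_norm_sq \<Omega> w0 w1 (\<lambda>x. u x - \<phi> x) (\<lambda>x. G x - grad \<phi> x) < ennreal (e / 2 / C)"
      using uG e unfolding H1_completion_def by (auto dest!: spec[of _ "e/2/C"])
    note [measurable] = C0_infinity_measurable[OF assms(1,2) \<phi>]
    let ?\<psi> = "\<lambda>x. softplus k (\<phi> x)"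
    let ?f = "\<lambda>x. (norm (G x - grad \<phi> x))\<^sup>2 * w1 x + \<bar>u x - \<phi> x\<bar>\<^sup>2 * w0 x"
    have "H1_norm_sq \<Omega> w0 w1 (\<lambda>x. max (u x) 0 - ?\<psi> x)
        (\<lambda>x. ((1 + sgn (u x)) / 2) *\<^sub>R G x - grad ?\<psi> x) \<le> (\<integral>\<^sup>+x. ennreal (R n x) + ennreal C * ennreal (?f x) \<partial>?M)"
      unfolding H1_norm_sq_def
    proof (rule nn_integral_mono)
      fix x assume "x \<in> space ?M"
      then have x: "x \<in> \<Omega>" by simp
      have grad: "grad ?\<psi> x = logistic (k * \<phi> x) *\<^sub>R grad \<phi> x"
        using k by (intro C0_infinity_softplus(2)[OF assms(1) _ \<phi> x]) simp
      have "(norm (((1 + sgn (u x)) / 2) *\<^sub>R G x - grad ?\<psi> x))\<^sup>2 * w1 x + \<bar>max (u x) 0 - ?\<psi> x\<bar>\<^sup>2 * w0 x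
          \<le> R n x + C * ?f x"
        unfolding grad R_def C_def k_def[symmetric] using w[OF x] by (intro softplus_pointwise[OF k])
      then have "ennreal ((norm (((1 + sgn (u x)) / 2) *\<^sub>R G x - grad ?\<psi> x))\<^sup>2 * w1 x + \<bar>max (u x) 0 - ?\<psi> x\<bar>\<^sup>2 * w0 x)
          \<le> ennreal (R n x + C * ?f x)" by (rule ennreal_leI)
      also have "\<dots> = ennreal (R n x) + ennreal C * ennreal (?f x)"
      proof -
        have "0 \<le> R n x" unfolding R_def using w[OF x] by (intro pos_part_error_bound) auto
        moreover have "0 \<le> ?f x" using w[OF x] by simp
        ultimately show ?thesis using C by (simp only: ennreal_plus ennreal_mult' less_imp_le mult_nonneg_nonneg)
      qed
      finally show "ennreal ((norm (((1 + sgn (u x)) / 2) *\<^sub>R G x - grad ?\<psi> x))\<^sup>2 * w1 x + \<bar>max (u x) 0 - ?\<psi> x\<bar>\<^sup>2 * w0 x) \<le> \<dots>" .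
    qed
    also have "\<dots> = (\<integral>\<^sup>+x. ennreal (R n x) \<partial>?M) + ennreal C * H1_norm_sq \<Omega> w0 w1 (\<lambda>x. u x - \<phi> x) (\<lambda>x. G x - grad \<phi> x)"
      unfolding H1_norm_sq_def by (subst nn_integral_add) (auto simp: nn_integral_cmult)
    also have "\<dots> < ennreal (e/2) + ennreal (e/2)"
    proof (rule add_strict_mono[OF n])
      have "ennreal C * H1_norm_sq \<Omega> w0 w1 (\<lambda>x. u x - \<phi> x) (\<lambda>x. G x - grad \<phi> x) < ennreal C * ennreal (e / 2 / C)"
        using C less by (intro ennreal_mult_strict_left_mono) auto
      also have "\<dots> = ennreal (e / 2)" using C e by (simp flip: ennreal_mult')
      finally show "ennreal C * H1_norm_sq \<Omega> w0 w1 (\<lambda>x. u x - \<phi> x) (\<lambda>x. G x - grad \<phi> x) < ennreal (e / 2)" .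
    qed
    also have "\<dots> = ennreal e" using e by (simp flip: ennreal_plus)
    finally show ?thesis
      using C0_infinity_softplus(1)[OF assms(1) _ \<phi>, of k] k by (intro bexI[of _ ?\<psi>]) auto
  qed
  then show ?thesis by (auto simp: H1_completion_def)
qed

lemma H1_completion_uminus:
  assumes "open \<Omega>" and uG: "(u, G) \<in> H1_completion \<Omega> w0 w1 (C0_infinity \<Omega> T)"
  shows "(\<lambda>x. - u x, \<lambda>x. - G x) \<in> H1_completion \<Omega> w0 w1 (C0_infinity \<Omega> T)"
proof -
  have "\<exists>\<psi>\<in>C0_infinity \<Omega> T. H1_norm_sq \<Omega> w0 w1 (\<lambda>x. - u x - \<psi> x) (\<lambda>x. - G x - grad \<psi> x) < ennreal e"
    if e: "e > 0" for e :: real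
  proof -
    obtain \<phi> where \<phi>: "\<phi> \<in> C0_infinity \<Omega> T"
      and less: "H1_norm_sq \<Omega> w0 w1 (\<lambda>x. u x - \<phi> x) (\<lambda>x. G x - grad \<phi> x) < ennreal e"
      using uG e unfolding H1_completion_def by auto
    have "H1_norm_sq \<Omega> w0 w1 (\<lambda>x. - u x - - \<phi> x) (\<lambda>x. - G x - grad (\<lambda>x. - \<phi> x) x)
        = H1_norm_sq \<Omega> w0 w1 (\<lambda>x. u x - \<phi> x) (\<lambda>x. G x - grad \<phi> x)"
      unfolding H1_norm_sq_def
    proof (rule nn_integral_cong)
      fix x assume "x \<in> space (lebesgue_on \<Omega>)"
      then have "grad (\<lambda>x. - \<phi> x) x = - grad \<phi> x" using C0_infinity_uminus(2)[OF assms(1) \<phi>] by simp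
      then show "ennreal ((norm (- G x - grad (\<lambda>x. - \<phi> x) x))\<^sup>2 * w1 x + \<bar>- u x - - \<phi> x\<bar>\<^sup>2 * w0 x)
         = ennreal ((norm (G x - grad \<phi> x))\<^sup>2 * w1 x + \<bar>u x - \<phi> x\<bar>\<^sup>2 * w0 x)"
        by (simp add: norm_minus_commute abs_minus_commute)
    qed
    then show ?thesis using less C0_infinity_uminus(1)[OF assms(1) \<phi>] by (intro bexI[of _ "\<lambda>x. - \<phi> x"]) auto
  qed
  then show ?thesis using uG by (auto simp: H1_completion_def)
qed

section \<open>Comparison\<close>

text \<open>
  One and the same gradient must serve for both approximations, by test functions on the closure
  and by those supported in \<^term>\<open>\<Omega> \<union> \<Sigma>\<close>.
\<close>

lemma H1_0_iff:
  "u \<in> H1_0 \<Omega> \<Sigma> w0 w1 \<longleftrightarrow>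
     (\<exists>G. (u, G) \<in> H1_completion \<Omega> w0 w1 (C0_infinity \<Omega> (closure \<Omega>)) \<and>
          (u, G) \<in> H1_completion \<Omega> w0 w1 (C0_infinity \<Omega> (\<Omega> \<union> \<Sigma>)))"
  unfolding H1_0_def H1_completion_def by (auto simp: image_iff)

lemma H1_0_pos_part:
  assumes "open \<Omega>" "weight_function \<Omega> w0" "weight_function \<Omega> w1" "u \<in> H1_0 \<Omega> \<Sigma> w0 w1"
  shows "(\<lambda>x. max (u x) 0) \<in> H1_0 \<Omega> \<Sigma> w0 w1"
  using assms(4) H1_completion_pos_part[OF assms(1) closure_subset assms(2,3)]
    H1_completion_pos_part[OF assms(1) Un_upper1 assms(2,3)]
  unfolding H1_0_iff by blast

lemma H1_0_uminus:
  assumes "open \<Omega>" "u \<in> H1_0 \<Omega> \<Sigma> w0 w1"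
  shows "(\<lambda>x. - u x) \<in> H1_0 \<Omega> \<Sigma> w0 w1"
  using assms(2) H1_completion_uminus[OF assms(1)] unfolding H1_0_iff by blast

lemma H1_uminus:
  assumes "open \<Omega>" "u \<in> H1 \<Omega> w0 w1"
  shows "(\<lambda>x. - u x) \<in> H1 \<Omega> w0 w1"
proof -
  obtain G where "(u, G) \<in> H1_completion \<Omega> w0 w1 (C0_infinity \<Omega> (closure \<Omega>))"
    using assms(2) by (auto simp: H1_def)
  from H1_completion_uminus[OF assms(1) this] show ?thesis unfolding H1_def by force
qed

lemma H1_0_subset_H1: "H1_0 \<Omega> \<Sigma> w0 w1 \<subseteq> H1 \<Omega> w0 w1"
  unfolding H1_def by (force simp: H1_0_iff)

text \<open>The sum is twice the midpoint.\<close>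

lemma convex_cone_in_add:
  assumes "convex_cone_in \<Omega> H K" "f \<in> K" "g \<in> K"
  shows "(\<lambda>x. f x + g x) \<in> K"
proof -
  have "\<forall>f\<in>K. \<forall>g\<in>K. \<forall>t\<in>{0..1}. (\<lambda>x. (1 - t) * f x + t * g x) \<in> K"
    using assms(1) by (simp add: convex_cone_in_def)
  from this[rule_format, OF assms(2,3), of "1/2"]
  have "(\<lambda>x. (1 - 1/2) * f x + 1/2 * g x) \<in> K" by simp
  moreover have "\<forall>f\<in>K. \<forall>c>0. (\<lambda>x. c * f x) \<in> K" using assms(1) by (simp add: convex_cone_in_def)
  ultimately have "(\<lambda>x. 2 * ((1 - 1/2) * f x + 1/2 * g x)) \<in> K"
    by (metis (no_types) zero_less_numeral)
  then show ?thesis by (simp add: algebra_simps)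
qed

lemma weak_maximum_principle_comparison:
  assumes "open \<Omega>"
    and bil: "bilinear_map_on \<Omega> (H1 \<Omega> w0 w1) a"
    and wmp: "weak_maximum_principle \<Omega> \<Sigma> w0 w1 a K"
    and uv: "u \<in> H1 \<Omega> w0 w1" "v \<in> H1 \<Omega> w0 w1" "(\<lambda>x. u x - v x) \<in> K"
    and le: "form_le \<Omega> \<Sigma> w0 w1 a u v" "boundary_le \<Omega> \<Sigma> w0 w1 u v"
  shows "ae_le \<Omega> u v"
proof -
  let ?H = "H1 \<Omega> w0 w1"
  have v: "(\<lambda>x. (-1) * v x) \<in> ?H" using H1_uminus[OF assms(1) uv(2)] by simp
  have add: "\<And>f g h. f \<in> ?H \<Longrightarrow> g \<in> ?H \<Longrightarrow> h \<in> ?H \<Longrightarrow> a (\<lambda>x. f x + g x) h = a f h + a g h"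
    and scale: "\<And>c f h. f \<in> ?H \<Longrightarrow> h \<in> ?H \<Longrightarrow> a (\<lambda>x. c * f x) h = c * a f h"
    using bil by (simp_all add: bilinear_map_on_def)
  have "a (\<lambda>x. u x - v x) \<phi> = a u \<phi> - a v \<phi>" if "\<phi> \<in> ?H" for \<phi>
    using add[OF uv(1) v that] scale[OF uv(2) that, of "-1"] by simp
  then have "\<forall>\<phi>\<in>H1_0 \<Omega> \<Sigma> w0 w1. ae_le \<Omega> (\<lambda>x. 0) \<phi> \<longrightarrow> a (\<lambda>x. u x - v x) \<phi> \<le> 0"
    using le(1) H1_0_subset_H1 unfolding form_le_def by fastforce
  moreover have "boundary_le \<Omega> \<Sigma> w0 w1 (\<lambda>x. u x - v x) (\<lambda>x. 0)"
    using le(2) by (simp add: boundary_le_def)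
  ultimately have "ae_le \<Omega> (\<lambda>x. u x - v x) (\<lambda>x. 0)"
    using wmp uv(3) unfolding weak_maximum_principle_def by blast
  then show ?thesis by (simp add: ae_le_def)
qed

theorem proposition6p4:
  fixes \<Omega> \<Sigma> :: "(real^'d) set"
    and w0 w1 :: "real^'d \<Rightarrow> real"
    and a :: "(real^'d \<Rightarrow> real) \<Rightarrow> (real^'d \<Rightarrow> real) \<Rightarrow> real"
    and K :: "(real^'d \<Rightarrow> real) set"
    and u v :: "real^'d \<Rightarrow> real"
  assumes "open \<Omega>"
    and "weight_function \<Omega> w0" and "weight_function \<Omega> w1"
    and "openin (top_of_set (frontier \<Omega>)) \<Sigma>"
    and "bilinear_map_on \<Omega> (H1 \<Omega> w0 w1) a"
    and "convex_cone_in \<Omega> (H1 \<Omega> w0 w1) K"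
    and "weak_maximum_principle \<Omega> \<Sigma> w0 w1 a K"
    and "u \<in> K" and "(\<lambda>x. - v x) \<in> K"
  shows "(form_le \<Omega> \<Sigma> w0 w1 a u v \<and> boundary_le \<Omega> \<Sigma> w0 w1 u v \<longrightarrow> ae_le \<Omega> u v) \<and>
         ((\<lambda>x. v x - u x) \<in> K \<and>
          form_eq \<Omega> \<Sigma> w0 w1 a u v \<and> boundary_eq \<Omega> \<Sigma> w0 w1 u v \<longrightarrow> ae_eq \<Omega> u v)"
proof (intro conjI impI; elim conjE)
  have H: "u \<in> H1 \<Omega> w0 w1" "v \<in> H1 \<Omega> w0 w1"
    using assms(6,8,9) H1_uminus[OF assms(1), of "\<lambda>x. - v x"] by (auto simp: convex_cone_in_def)
  have uv: "(\<lambda>x. u x - v x) \<in> K" using convex_cone_in_add[OF assms(6,8,9)] by simp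
  note compare = weak_maximum_principle_comparison[OF assms(1,5,7)]
  {
    assume "form_le \<Omega> \<Sigma> w0 w1 a u v" "boundary_le \<Omega> \<Sigma> w0 w1 u v"
    then show "ae_le \<Omega> u v" by (rule compare[OF H uv])
  next
    assume vu: "(\<lambda>x. v x - u x) \<in> K"
      and form: "form_eq \<Omega> \<Sigma> w0 w1 a u v" and bdry: "boundary_eq \<Omega> \<Sigma> w0 w1 u v"
    have d: "(\<lambda>x. u x - v x) \<in> H1_0 \<Omega> \<Sigma> w0 w1" using bdry by (simp add: boundary_eq_def)
    then have d': "(\<lambda>x. v x - u x) \<in> H1_0 \<Omega> \<Sigma> w0 w1"
      using H1_0_uminus[OF assms(1) d] by simp
    have "form_le \<Omega> \<Sigma> w0 w1 a u v" "form_le \<Omega> \<Sigma> w0 w1 a v u"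
      using form by (simp_all add: form_eq_def form_le_def)
    moreover have "boundary_le \<Omega> \<Sigma> w0 w1 u v" "boundary_le \<Omega> \<Sigma> w0 w1 v u"
      using H1_0_pos_part[OF assms(1-3) d] H1_0_pos_part[OF assms(1-3) d']
      by (simp_all add: boundary_le_def)
    ultimately have "ae_le \<Omega> u v" "ae_le \<Omega> v u"
      using compare[OF H uv] compare[OF H(2,1) vu] by simp_all
    then show "ae_eq \<Omega> u v" unfolding ae_le_def ae_eq_def by eventually_elim simp
  }
qed

end
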